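(* Let $\alpha\in\left[\frac{1}{n+1},1\right)$, and for every $y\in\mathcal{Y}$ let $\widetilde{S}^{\mathrm{up}}_{\lambda;D^y}(\cdot,\cdot)$ and $\widetilde{S}^{\mathrm{lo}}_{\lambda;D^y}(\cdot,\cdot)$ be upper- and lower-approximate non-conformity score functions, i.e. almost surely $$\widetilde{S}^{\mathrm{lo}}_{\lambda;D^y}(x,u)\le S_{\lambda;D^y}(x,u)\le \widetilde{S}^{\mathrm{up}}_{\lambda;D^y}(x,u)\qquad\text{for every }(x,u)\in\mathcal{X}\times\mathcal{Y}\text{ and every } y\in\mathcal{Y}.$$ Then the upper-approximate full-conformal prediction region contains the full-conformal prediction region, $$\widehat{C}^{\mathrm{full}}_{\lambda;\alpha}(X_{n+1})\subseteq\widetilde{C}^{\mathrm{up}}_{\lambda;\alpha}(X_{n+1})\quad\text{almost surely},$$ and consequently $$\mathbb{P}\left[Y_{n+1}\in\widetilde{C}^{\mathrm{up}}_{\lambda;\alpha}(X_{n+1})\right]\ge\mathbb{P}\left[Y_{n+1}\in\widehat{C}^{\mathrm{full}}_{\lambda;\alpha}(X_{n+1})\right]\ge 1-\alpha .$$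
   Context: Let $\mathcal{X}\subset\mathbb{R}^d$, $\mathcal{Y}\subset\mathbb{R}^p$, and let $(X_1,Y_1),\ldots,(X_{n+1},Y_{n+1})$ be exchangeable random variables with values in $\mathcal{X}\times\mathcal{Y}$. Let $\mathcal{H}$ be a reproducing kernel Hilbert space of functions $\mathcal{X}\to\mathbb{R}^p$, let $\ell:\mathbb{R}^p\times\mathbb{R}^p\to\mathbb{R}$ be a loss function and $\lambda\in(0,+\infty)$. For a finite data set $D'\subset\mathcal{X}\times\mathcal{Y}$ (an unordered collection, with repetitions allowed) of cardinality $|D'|$, the predictor $\hat f_{\lambda;D'}\in\mathcal{H}$ is the minimizer over $f\in\mathcal{H}$ (assumed to exist and be unique) of $\frac{1}{|D'|}\sum_{(x,y)\in D'}\ell(y,f(x))+\lambda\|f\|_{\mathcal{H}}^2$. Let $D$ be the data set consisting of $(X_1,Y_1),\ldots,(X_n,Y_n)$. For $y\in\mathcal{Y}$, $D^y$ is the data set consisting of $(X_1,Y_1),\ldots,(X_n,Y_n)$ and $(X_{n+1},y)$. A non-conformity function $\widehat{s}_{D^y}:\mathcal{Y}\times\mathbb{R}^p\to\mathbb{R}$ is given, which may depend on the (unordered) data set $D^y$. The non-conformity score is $S_{\lambda;D^y}(x,u):=\widehat{s}_{D^y}(u,\hat f_{\lambda;D^y}(x))$. The conformal p-value function and full-conformal prediction region are $$\widehat{\pi}^{\mathrm{full}}_{\lambda;D}(X_{n+1},y):=\frac{1+\sum_{i=1}^n\mathbf{1}\{S_{\lambda;D^y}(X_i,Y_i)\ge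 S_{\lambda;D^y}(X_{n+1},y)\}}{n+1},\qquad \widehat{C}^{\mathrm{full}}_{\lambda;\alpha}(X_{n+1}):=\{y\in\mathcal{Y}:\widehat{\pi}^{\mathrm{full}}_{\lambda;D}(X_{n+1},y)>\alpha\}.$$ The upper-approximate p-value function and region are $$\widetilde{\pi}^{\mathrm{up}}_{\lambda;D}(X_{n+1},y):=\frac{1+\sum_{i=1}^n\mathbf{1}\{\widetilde S^{\mathrm{up}}_{\lambda;D^y}(X_i,Y_i)\ge \widetilde S^{\mathrm{lo}}_{\lambda;D^y}(X_{n+1},y)\}}{n+1},\qquad \widetilde{C}^{\mathrm{up}}_{\lambda;\alpha}(X_{n+1}):=\{y\in\mathcal{Y}:\widetilde{\pi}^{\mathrm{up}}_{\lambda;D}(X_{n+1},y)>\alpha\}.$$ *)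

theory Defs
  imports "HOL-Probability.Probability"
begin

text \<open>Equality of the joint laws of \<open>(Z 1, \<dots>, Z N)\<close> under all permutations of \<open>{1..N}\<close>.\<close>

definition exchangeable ::
  "'w measure \<Rightarrow> 'z measure \<Rightarrow> nat \<Rightarrow> (nat \<Rightarrow> 'w \<Rightarrow> 'z) \<Rightarrow> bool" where
  "exchangeable M S N Z \<longleftrightarrow>
     (\<forall>i\<in>{1..N}. Z i \<in> M \<rightarrow>\<^sub>M S) \<and>
     (\<forall>\<sigma>. \<sigma> permutes {1..N} \<longrightarrow>
        distr M (Pi\<^sub>M {1..N} (\<lambda>_. S)) (\<lambda>\<omega>. \<lambda>i\<in>{1..N}. Z (\<sigma> i) \<omega>) =
        distr M (Pi\<^sub>M {1..N} (\<lambda>_. S)) (\<lambda>\<omega>. \<lambda>i\<in>{1..N}. Z i \<omega>))"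

text \<open>
  A Hilbert space of functions is a Hilbert space \<open>'h\<close> together with an evaluation map
  \<open>app :: 'h \<Rightarrow> 'x \<Rightarrow> 'v\<close>, where \<open>app f x\<close> is the value \<open>f(x)\<close>. Elements of \<open>'h\<close> are
  determined by their values on \<open>\<X>\<close>, the vector space operations are pointwise, and
  evaluation at each point of \<open>\<X>\<close> is continuous. Values of \<open>app f\<close> outside \<open>\<X>\<close> are irrelevant.
\<close>

definition rkhs ::
  "'x set \<Rightarrow> ('h::{real_inner,complete_space} \<Rightarrow> 'x \<Rightarrow> 'v::real_normed_vector) \<Rightarrow> bool" where
  "rkhs \<X> app \<longleftrightarrow>
     (\<forall>x\<in>\<X>. bounded_linear (\<lambda>f. app f x)) \<and>
     (\<forall>f g. (\<forall>x\<in>\<X>. app f x = app g x) \<longrightarrow> f = g)"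

definition reg_risk ::
  "('h::real_inner \<Rightarrow> 'x \<Rightarrow> 'v) \<Rightarrow> ('v \<Rightarrow> 'v \<Rightarrow> real) \<Rightarrow> real \<Rightarrow> ('x \<times> 'v) multiset \<Rightarrow> 'h \<Rightarrow> real" where
  "reg_risk app l lam D f =
     1 / real (size D) * (\<Sum>(x, y)\<in>#D. l y (app f x)) + lam * (norm f)\<^sup>2"

definition is_minimizer :: "('h \<Rightarrow> real) \<Rightarrow> 'h \<Rightarrow> bool" where
  "is_minimizer J f \<longleftrightarrow> (\<forall>g. J f \<le> J g)"

definition predictor ::
  "('h::real_inner \<Rightarrow> 'x \<Rightarrow> 'v) \<Rightarrow> ('v \<Rightarrow> 'v \<Rightarrow> real) \<Rightarrow> real \<Rightarrow> ('x \<times> 'v) multiset \<Rightarrow> 'h" where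
  "predictor app l lam D = (THE f. is_minimizer (reg_risk app l lam D) f)"

definition score ::
  "('h::real_inner \<Rightarrow> 'x \<Rightarrow> 'v) \<Rightarrow> ('v \<Rightarrow> 'v \<Rightarrow> real) \<Rightarrow> real \<Rightarrow>
   (('x \<times> 'v) multiset \<Rightarrow> 'v \<Rightarrow> 'v \<Rightarrow> real) \<Rightarrow> ('x \<times> 'v) multiset \<Rightarrow> 'x \<Rightarrow> 'v \<Rightarrow> real" where
  "score app l lam s D x u = s D u (app (predictor app l lam D) x)"

text \<open>
  A realization of the sample is a function \<open>z\<close> with \<open>z i = (x\<^sub>i, y\<^sub>i)\<close> for \<open>i \<in> {1..n+1}\<close>.
  The data sets, p-values and regions below never use the response \<open>snd (z (n + 1))\<close>.
\<close>

definition sample :: "(nat \<Rightarrow> 'w \<Rightarrow> 'x) \<Rightarrow> (nat \<Rightarrow> 'w \<Rightarrow> 'v) \<Rightarrow> 'w \<Rightarrow> nat \<Rightarrow> 'x \<times> 'v" where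
  "sample X Y \<omega> i = (X i \<omega>, Y i \<omega>)"

definition augmented_data :: "nat \<Rightarrow> (nat \<Rightarrow> 'x \<times> 'v) \<Rightarrow> 'v \<Rightarrow> ('x \<times> 'v) multiset" where
  "augmented_data n z y = image_mset z (mset_set {1..n}) + {#(fst (z (n + 1)), y)#}"

text \<open>
  \<open>S D\<close> is the score function computed from the data set \<open>D\<close>. In contrast, the approximate
  scores \<open>S_up\<close> and \<open>S_lo\<close> are indexed by the candidate response \<open>y\<close> only: they will be random
  functions, so that they may depend on the augmented data set in an arbitrary way.
\<close>

definition full_pvalue ::
  "nat \<Rightarrow> (('x \<times> 'v) multiset \<Rightarrow> 'x \<Rightarrow> 'v \<Rightarrow> real) \<Rightarrow> (nat \<Rightarrow> 'x \<times> 'v) \<Rightarrow> 'v \<Rightarrow> real" where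
  "full_pvalue n S z y =
     (1 + (\<Sum>i=1..n. of_bool (S (augmented_data n z y) (fst (z i)) (snd (z i))
                              \<ge> S (augmented_data n z y) (fst (z (n + 1))) y))) / (real n + 1)"

definition full_region ::
  "'v set \<Rightarrow> nat \<Rightarrow> real \<Rightarrow> (('x \<times> 'v) multiset \<Rightarrow> 'x \<Rightarrow> 'v \<Rightarrow> real) \<Rightarrow> (nat \<Rightarrow> 'x \<times> 'v) \<Rightarrow> 'v set" where
  "full_region \<Y> n \<alpha> S z = {y \<in> \<Y>. full_pvalue n S z y > \<alpha>}"

definition upper_pvalue ::
  "nat \<Rightarrow> ('v \<Rightarrow> 'x \<Rightarrow> 'v \<Rightarrow> real) \<Rightarrow> ('v \<Rightarrow> 'x \<Rightarrow> 'v \<Rightarrow> real) \<Rightarrow> (nat \<Rightarrow> 'x \<times> 'v) \<Rightarrow> 'v \<Rightarrow> real" where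
  "upper_pvalue n S_up S_lo z y =
     (1 + (\<Sum>i=1..n. of_bool (S_up y (fst (z i)) (snd (z i))
                              \<ge> S_lo y (fst (z (n + 1))) y))) / (real n + 1)"

definition upper_region ::
  "'v set \<Rightarrow> nat \<Rightarrow> real \<Rightarrow> ('v \<Rightarrow> 'x \<Rightarrow> 'v \<Rightarrow> real) \<Rightarrow> ('v \<Rightarrow> 'x \<Rightarrow> 'v \<Rightarrow> real) \<Rightarrow>
   (nat \<Rightarrow> 'x \<times> 'v) \<Rightarrow> 'v set" where
  "upper_region \<Y> n \<alpha> S_up S_lo z = {y \<in> \<Y>. upper_pvalue n S_up S_lo z y > \<alpha>}"

end

theory Submission
  imports Defs
begin

text \<open>
  With the true response plugged in, the augmented data set is the full sample, a symmetric
  function of it. So \<open>(n + 1)\<close> times the \<open>p\<close>-value is the rank (from above) of the last score among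
  all \<open>n + 1\<close> scores. At most \<open>\<alpha> (n + 1)\<close> indices can have rank \<open>\<le> \<alpha> (n + 1)\<close>, and by
  exchangeability each index is equally likely to be among them; averaging over the
  transpositions with \<open>n + 1\<close> bounds the probability of non-coverage by \<open>\<alpha>\<close>.
\<close>

text \<open>Among the elements of small rank, take one, \<open>j\<close>, with the least value of
  \<open>g\<close>. All the others have value at least \<open>g j\<close>, so they are counted in
  the rank of \<open>j\<close>, which is at most \<open>c\<close>. Ties are harmless because the
  rank counts them.\<close>

lemma card_small_rank_le:
  fixes g :: "'a \<Rightarrow> 'b::linorder"
  assumes "finite A" "0 \<le> c"
  shows "real (card {j\<in>A. real (card {i\<in>A. g j \<le> g i}) \<le> c}) \<le> c"
proof (cases "{j\<in>A. real (card {i\<in>A. g j \<le> g i}) \<le> c} = {}")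
  case True
  with assms(2) show ?thesis by (simp only: card.empty of_nat_0)
next
  case False
  let ?B = "{j\<in>A. real (card {i\<in>A. g j \<le> g i}) \<le> c}"
  \<comment> \<open>\<open>arg_min_on\<close> only excludes strictly smaller values; linearity of
    the order turns this into a lower bound on the whole set.\<close>
  obtain j where j: "j \<in> ?B" "\<And>k. k \<in> ?B \<Longrightarrow> g j \<le> g k"
  proof -
    have "finite ?B" using assms(1) by simp
    from arg_min_if_finite[OF this False, of g] show thesis
      by (intro that[of "arg_min_on g ?B"]) (simp_all only: not_less[symmetric], blast+)
  qed
  have "card ?B \<le> card {i\<in>A. g j \<le> g i}"
    using j assms(1) by (intro card_mono) auto
  then show ?thesis using j(1) by auto
qed

lemma augmented_data_response:
  "augmented_data n z (snd (z (n + 1))) = image_mset z (mset_set {1..n+1})"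
  by (simp add: augmented_data_def atLeastAtMostSuc_conv)

text \<open>The leading 1 in the numerator is the comparison of index \<open>n + 1\<close> with
  itself, so the numerator becomes a rank among all \<open>n + 1\<close> scores.\<close>

lemma full_pvalue_response:
  "full_pvalue n S z (snd (z (n + 1))) =
     real (card {i\<in>{1..n+1}.
       S (image_mset z (mset_set {1..n+1})) (fst (z (n + 1))) (snd (z (n + 1)))
       \<le> S (image_mset z (mset_set {1..n+1})) (fst (z i)) (snd (z i))}) / (real n + 1)"
proof -
  define h where "h i = S (image_mset z (mset_set {1..n+1})) (fst (z i)) (snd (z i))" for i
  have "real (card {i\<in>{1..n+1}. h (n + 1) \<le> h i}) = (\<Sum>i=1..n+1. of_bool (h (n + 1) \<le> h i))"
    by (subst sum_of_bool_eq) (simp_all only: Int_def mem_Collect_eq finite_atLeastAtMost)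
  also have "\<dots> = 1 + (\<Sum>i=1..n. of_bool (h (n + 1) \<le> h i))"
    by simp
  finally show ?thesis
    unfolding full_pvalue_def augmented_data_response h_def by simp
qed

text \<open>Permuting the sample leaves its multiset, hence the score function, unchanged and merely
  reindexes the scores; the bijection \<sigma> preserves the count. So the permutation matters only
  through the index it puts in the test position.\<close>

lemma full_pvalue_permuted:
  assumes "\<sigma> permutes {1..n+1}"
    and z': "\<And>i. i \<in> {1..n+1} \<Longrightarrow> z' i = z (\<sigma> i)"
  shows "full_pvalue n S z' (snd (z' (n + 1))) =
     real (card {i\<in>{1..n+1}.
       S (image_mset z (mset_set {1..n+1})) (fst (z (\<sigma> (n + 1)))) (snd (z (\<sigma> (n + 1))))
       \<le> S (image_mset z (mset_set {1..n+1})) (fst (z i)) (snd (z i))}) / (real n + 1)"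
proof -
  let ?I = "{1..n+1}"
  define h where "h i = S (image_mset z (mset_set ?I)) (fst (z i)) (snd (z i))" for i
  have "image_mset z' (mset_set ?I) = image_mset z (image_mset \<sigma> (mset_set ?I))"
    using z' by (auto simp: multiset.map_comp intro!: image_mset_cong)
  also have "image_mset \<sigma> (mset_set ?I) = mset_set ?I"
    using assms(1) by (simp add: image_mset_mset_set permutes_image permutes_inj_on)
  finally have D: "image_mset z' (mset_set ?I) = image_mset z (mset_set ?I)" .
  have h': "S (image_mset z' (mset_set ?I)) (fst (z' i)) (snd (z' i)) = h (\<sigma> i)" if "i \<in> ?I" for i
    using that by (simp only: D z' h_def)
  have "{i\<in>?I. h (\<sigma> (n + 1)) \<le> h i} = \<sigma> ` {i\<in>?I. h (\<sigma> (n + 1)) \<le> h (\<sigma> i)}"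
  proof -
    have "{i\<in>?I. h (\<sigma> (n + 1)) \<le> h i} = {i \<in> \<sigma> ` ?I. h (\<sigma> (n + 1)) \<le> h i}"
      by (simp only: permutes_image[OF assms(1)])
    then show ?thesis by (simp only: Compr_image_eq)
  qed
  then have "card {i\<in>?I. h (\<sigma> (n + 1)) \<le> h (\<sigma> i)} = card {i\<in>?I. h (\<sigma> (n + 1)) \<le> h i}"
    using permutes_inj_on[OF assms(1)] by (simp add: card_image)
  moreover have "{i\<in>?I. S (image_mset z' (mset_set ?I)) (fst (z' (n + 1))) (snd (z' (n + 1)))
       \<le> S (image_mset z' (mset_set ?I)) (fst (z' i)) (snd (z' i))}
     = {i\<in>?I. h (\<sigma> (n + 1)) \<le> h (\<sigma> i)}"
    using h' by (intro Collect_cong conj_cong refl) simp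
  ultimately show ?thesis
    unfolding full_pvalue_response h_def by simp
qed

text \<open>Bridges tuples of the product space, which are \<open>undefined\<close> outside
  \<open>{1..n+1}\<close>, and samples given as functions on all indices.\<close>

lemma full_region_cong:
  assumes "\<And>i. i \<in> {1..n+1} \<Longrightarrow> z i = z' i"
  shows "full_region \<Y> n \<alpha> S z = full_region \<Y> n \<alpha> S z'"
proof -
  have "augmented_data n z y = augmented_data n z' y" for y
    unfolding augmented_data_def using assms by (auto intro!: image_mset_cong)
  moreover have "z (n + 1) = z' (n + 1)" "\<And>i. i \<in> {1..n} \<Longrightarrow> z i = z' i"
    using assms by auto
  ultimately show ?thesis
    unfolding full_region_def full_pvalue_def
    by (intro Collect_cong conj_cong refl arg_cong2[where f = "(<)"] arg_cong2[where f = "(/)"]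
        arg_cong2[where f = "(+)"] sum.cong) simp
qed

text \<open>Raising the scores of the observed points and lowering that of the candidate can only
  switch indicators from 0 to 1, so the p-value grows. The argument is deterministic, for one
  realization.\<close>

lemma full_region_subset_upper_region:
  assumes bounds: "\<And>y x u. y \<in> \<Y> \<Longrightarrow> x \<in> \<X> \<Longrightarrow> u \<in> \<Y> \<Longrightarrow>
      S_lo y x u \<le> S (augmented_data n z y) x u \<and> S (augmented_data n z y) x u \<le> S_up y x u"
    and z: "\<And>i. i \<in> {1..n+1} \<Longrightarrow> z i \<in> \<X> \<times> \<Y>"
  shows "full_region \<Y> n \<alpha> S z \<subseteq> upper_region \<Y> n \<alpha> S_up S_lo z"
proof
  fix y assume y: "y \<in> full_region \<Y> n \<alpha> S z"
  then have "y \<in> \<Y>" by (simp add: full_region_def)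
  have "full_pvalue n S z y \<le> upper_pvalue n S_up S_lo z y"
    unfolding full_pvalue_def upper_pvalue_def
  proof (intro divide_right_mono add_left_mono sum_mono)
    fix i assume "i \<in> {1..n}"
    then have "z i \<in> \<X> \<times> \<Y>" "z (n + 1) \<in> \<X> \<times> \<Y>" using z by auto
    then have "S (augmented_data n z y) (fst (z i)) (snd (z i)) \<le> S_up y (fst (z i)) (snd (z i))"
      and "S_lo y (fst (z (n + 1))) y \<le> S (augmented_data n z y) (fst (z (n + 1))) y"
      using bounds \<open>y \<in> \<Y>\<close> by (auto simp: mem_Times_iff)
    then show "of_bool (S (augmented_data n z y) (fst (z (n + 1))) y
                 \<le> S (augmented_data n z y) (fst (z i)) (snd (z i)))
        \<le> (of_bool (S_lo y (fst (z (n + 1))) y \<le> S_up y (fst (z i)) (snd (z i))) :: real)"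
      by (simp add: of_bool_def)
  qed simp
  then show "y \<in> upper_region \<Y> n \<alpha> S_up S_lo z"
    using y by (simp add: full_region_def upper_region_def)
qed

lemma exchangeable_measure_permuted:
  assumes ex: "exchangeable M S N Z" and \<sigma>: "\<sigma> permutes {1..N}"
    and B: "B \<in> sets (Pi\<^sub>M {1..N} (\<lambda>_. S))"
  shows "(\<lambda>\<omega>. \<lambda>i\<in>{1..N}. Z (\<sigma> i) \<omega>) \<in> M \<rightarrow>\<^sub>M Pi\<^sub>M {1..N} (\<lambda>_. S)"
    and "measure M {\<omega> \<in> space M. (\<lambda>i\<in>{1..N}. Z (\<sigma> i) \<omega>) \<in> B} =
         measure M {\<omega> \<in> space M. (\<lambda>i\<in>{1..N}. Z i \<omega>) \<in> B}"
proof -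
  have meas: "(\<lambda>\<omega>. \<lambda>i\<in>{1..N}. Z (\<tau> i) \<omega>) \<in> M \<rightarrow>\<^sub>M Pi\<^sub>M {1..N} (\<lambda>_. S)"
    if "\<tau> permutes {1..N}" for \<tau>
    using ex permutes_in_image[OF that]
    by (intro measurable_restrict) (simp add: exchangeable_def)
  \<comment> \<open>Stated for every \<tau> so that \<sigma> and the identity give the two sides of
    the equality of laws.\<close>
  have law: "measure (distr M (Pi\<^sub>M {1..N} (\<lambda>_. S)) (\<lambda>\<omega>. \<lambda>i\<in>{1..N}. Z (\<tau> i) \<omega>)) B =
      measure M {\<omega> \<in> space M. (\<lambda>i\<in>{1..N}. Z (\<tau> i) \<omega>) \<in> B}" if "\<tau> permutes {1..N}" for \<tau>
    using measure_distr[OF meas[OF that] B] by (simp add: vimage_def Int_def conj_commute)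
  show "(\<lambda>\<omega>. \<lambda>i\<in>{1..N}. Z (\<sigma> i) \<omega>) \<in> M \<rightarrow>\<^sub>M Pi\<^sub>M {1..N} (\<lambda>_. S)"
    by (rule meas[OF \<sigma>])
  show "measure M {\<omega> \<in> space M. (\<lambda>i\<in>{1..N}. Z (\<sigma> i) \<omega>) \<in> B} =
        measure M {\<omega> \<in> space M. (\<lambda>i\<in>{1..N}. Z i \<omega>) \<in> B}"
    using ex \<sigma> law[OF \<sigma>] law[OF permutes_id] by (simp add: exchangeable_def)
qed

text \<open>Symmetry of the score in the data is built into the type of \<open>S\<close>, whose data
  argument is a multiset. Measurability is asked for in the sample space so that the event can be
  pulled back along every permuted sample.\<close>

lemma full_region_coverage:
  fixes Z :: "nat \<Rightarrow> 'w \<Rightarrow> 'x \<times> 'v"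
  assumes "prob_space M"
    and ex: "exchangeable M R (n + 1) Z"
    and Y: "\<And>z. z \<in> space R \<Longrightarrow> snd z \<in> \<Y>"
    and "0 \<le> \<alpha>"
    and meas: "{z \<in> space (Pi\<^sub>M {1..n+1} (\<lambda>_. R)). snd (z (n + 1)) \<in> full_region \<Y> n \<alpha> S z}
           \<in> sets (Pi\<^sub>M {1..n+1} (\<lambda>_. R))"
  shows "{\<omega> \<in> space M. snd (Z (n + 1) \<omega>) \<in> full_region \<Y> n \<alpha> S (\<lambda>i. Z i \<omega>)} \<in> sets M"
    and "1 - \<alpha> \<le> measure M {\<omega> \<in> space M. snd (Z (n + 1) \<omega>) \<in> full_region \<Y> n \<alpha> S (\<lambda>i. Z i \<omega>)}"
proof -
  interpret prob_space M by fact
  let ?I = "{1..n+1}" and ?P = "Pi\<^sub>M {1..n+1} (\<lambda>_. R)"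
  define G where "G = {z \<in> space ?P. snd (z (n + 1)) \<in> full_region \<Y> n \<alpha> S z}"
  define T where "T \<sigma> \<omega> = (\<lambda>i\<in>?I. Z (\<sigma> i) \<omega>)" for \<sigma> :: "nat \<Rightarrow> nat" and \<omega>
  \<comment> \<open>\<open>B \<sigma>\<close> is the event that the \<sigma>-permuted sample is not
    covered.\<close>
  define B where "B \<sigma> = {\<omega> \<in> space M. T \<sigma> \<omega> \<in> space ?P - G}" for \<sigma>
  have G: "G \<in> sets ?P" unfolding G_def by (rule meas)
  have T: "T \<sigma> \<in> M \<rightarrow>\<^sub>M ?P" if "\<sigma> permutes ?I" for \<sigma>
    unfolding T_def by (rule exchangeable_measure_permuted(1)[OF ex that G])
  have B_sets: "B \<sigma> \<in> sets M" if "\<sigma> permutes ?I" for \<sigma>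
    using measurable_sets[OF T[OF that], of "space ?P - G"] G
    by (simp add: B_def vimage_def Int_def conj_commute sets.compl_sets)
  have B_prob: "prob (B \<sigma>) = prob (B id)" if "\<sigma> permutes ?I" for \<sigma>
    using exchangeable_measure_permuted(2)[OF ex that sets.compl_sets[OF G]]
    by (simp add: B_def T_def)
  \<comment> \<open>Puts point \<open>j\<close> into the test position; \<open>j = n + 1\<close>
    gives the identity.\<close>
  let ?\<tau> = "\<lambda>j. Transposition.transpose j (n + 1)"
  have perm: "?\<tau> j permutes ?I" if "j \<in> ?I" for j
    using that by (intro permutes_swap_id) auto
  \<comment> \<open>Membership in \<open>full_region\<close> also requires the response to lie in
    \<open>\<Y>\<close>; this holds throughout \<open>space R\<close>, so non-coverage is exactly a
    p-value of at most \<alpha>.\<close>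
  have B_iff: "\<omega> \<in> B \<sigma> \<longleftrightarrow> full_pvalue n S (T \<sigma> \<omega>) (snd (T \<sigma> \<omega> (n + 1))) \<le> \<alpha>"
    if "\<omega> \<in> space M" "\<sigma> permutes ?I" for \<omega> \<sigma>
  proof -
    have sp: "T \<sigma> \<omega> \<in> space ?P" using T[OF that(2)] that(1) by (rule measurable_space)
    then have "T \<sigma> \<omega> (n + 1) \<in> space R" by (auto simp: space_PiM)
    then show ?thesis using sp that(1) Y by (auto simp: B_def G_def full_region_def not_less)
  qed
  \<comment> \<open>For fixed \<omega> the scores \<open>h\<close> are the same for all
    transpositions, so the events that occur correspond to the indices of rank at most
    \<open>\<alpha> * (real n + 1)\<close>, and \<open>card_small_rank_le\<close> bounds their
    number.\<close>
  have count: "(\<Sum>j\<in>?I. indicator (B (?\<tau> j)) \<omega>) \<le> \<alpha> * (real n + 1)" if \<omega>: "\<omega> \<in> space M" for \<omega>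
  proof -
    define h where
      "h i = S (image_mset (\<lambda>i. Z i \<omega>) (mset_set ?I)) (fst (Z i \<omega>)) (snd (Z i \<omega>))" for i
    have *: "\<omega> \<in> B (?\<tau> j) \<longleftrightarrow> real (card {i\<in>?I. h j \<le> h i}) \<le> \<alpha> * (real n + 1)" if j: "j \<in> ?I" for j
    proof -
      have "full_pvalue n S (T (?\<tau> j) \<omega>) (snd (T (?\<tau> j) \<omega> (n + 1))) =
          real (card {i\<in>?I. h j \<le> h i}) / (real n + 1)"
        using full_pvalue_permuted[OF perm[OF j], of "T (?\<tau> j) \<omega>" "\<lambda>i. Z i \<omega>" S]
        by (simp add: T_def h_def)
      then show ?thesis
        unfolding B_iff[OF \<omega> perm[OF j]] by (simp add: pos_divide_le_eq)
    qed
    have "(\<Sum>j\<in>?I. indicator (B (?\<tau> j)) \<omega>) = real (card {j\<in>?I. \<omega> \<in> B (?\<tau> j)})"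
      unfolding indicator_def
      by (subst sum_of_bool_eq) (simp_all only: Int_def mem_Collect_eq finite_atLeastAtMost)
    also have "{j\<in>?I. \<omega> \<in> B (?\<tau> j)} = {j\<in>?I. real (card {i\<in>?I. h j \<le> h i}) \<le> \<alpha> * (real n + 1)}"
      using * by blast
    also have "real (card \<dots>) \<le> \<alpha> * (real n + 1)"
      using \<open>0 \<le> \<alpha>\<close> by (intro card_small_rank_le) auto
    finally show ?thesis .
  qed
  have ind: "integrable M (indicator (B (?\<tau> j)) :: _ \<Rightarrow> real)" if "j \<in> ?I" for j
    using B_sets[OF perm[OF that]] by (simp add: integrable_indicator_iff less_top[symmetric])
  \<comment> \<open>The \<open>n + 1\<close> events are equally likely, and the sum of their
    probabilities is the expectation of the count just bounded.\<close>
  have "(real n + 1) * prob (B id) = (\<Sum>j\<in>?I. prob (B (?\<tau> j)))"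
    using B_prob[OF perm] by simp
  also have "\<dots> = (\<integral>\<omega>. (\<Sum>j\<in>?I. indicator (B (?\<tau> j)) \<omega>) \<partial>M)"
    using ind B_sets[OF perm]
    by (subst Bochner_Integration.integral_sum) (auto simp: Int_absorb2 sets.sets_into_space)
  also have "\<dots> \<le> (\<integral>\<omega>. \<alpha> * (real n + 1) \<partial>M)"
    using ind count by (intro integral_mono Bochner_Integration.integrable_sum) auto
  finally have bound: "prob (B id) \<le> \<alpha>"
    by (simp add: prob_space mult.commute)
  \<comment> \<open>Back from restricted tuples to the original sample: coverage is the complement
    of \<open>B id\<close>.\<close>
  have C: "{\<omega> \<in> space M. snd (Z (n + 1) \<omega>) \<in> full_region \<Y> n \<alpha> S (\<lambda>i. Z i \<omega>)} = space M - B id"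
  proof -
    have "snd (Z (n + 1) \<omega>) \<in> full_region \<Y> n \<alpha> S (\<lambda>i. Z i \<omega>) \<longleftrightarrow> T id \<omega> \<in> G" if "\<omega> \<in> space M" for \<omega>
    proof -
      have "full_region \<Y> n \<alpha> S (T id \<omega>) = full_region \<Y> n \<alpha> S (\<lambda>i. Z i \<omega>)"
        by (rule full_region_cong) (simp add: T_def)
      moreover have "T id \<omega> \<in> space ?P"
        using T[OF permutes_id] that by (rule measurable_space)
      moreover have "T id \<omega> (n + 1) = Z (n + 1) \<omega>" by (simp add: T_def)
      ultimately show ?thesis by (simp add: G_def)
    qed
    moreover have "G \<subseteq> space ?P" by (auto simp: G_def)
    moreover have "T id \<omega> \<in> space ?P" if "\<omega> \<in> space M" for \<omega>
      using T[OF permutes_id] that by (rule measurable_space)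
    ultimately show ?thesis by (auto simp: B_def)
  qed
  show "{\<omega> \<in> space M. snd (Z (n + 1) \<omega>) \<in> full_region \<Y> n \<alpha> S (\<lambda>i. Z i \<omega>)} \<in> sets M"
    unfolding C using B_sets[OF permutes_id] by simp
  show "1 - \<alpha> \<le> prob {\<omega> \<in> space M. snd (Z (n + 1) \<omega>) \<in> full_region \<Y> n \<alpha> S (\<lambda>i. Z i \<omega>)}"
    unfolding C using bound B_sets[OF permutes_id] by (simp add: prob_compl)
qed

theorem mainTheorem1:
  fixes M :: "'w measure"
    and \<X> :: "(real ^ 'd) set" and \<Y> :: "(real ^ 'p) set"
    and n :: nat
    and X :: "nat \<Rightarrow> 'w \<Rightarrow> real ^ 'd" and Y :: "nat \<Rightarrow> 'w \<Rightarrow> real ^ 'p"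
    and app :: "'h::{real_inner,complete_space} \<Rightarrow> real ^ 'd \<Rightarrow> real ^ 'p"
    and l :: "real ^ 'p \<Rightarrow> real ^ 'p \<Rightarrow> real"
    and lam \<alpha> :: real
    and s :: "((real ^ 'd) \<times> (real ^ 'p)) multiset \<Rightarrow> real ^ 'p \<Rightarrow> real ^ 'p \<Rightarrow> real"
    and S_up S_lo :: "'w \<Rightarrow> real ^ 'p \<Rightarrow> real ^ 'd \<Rightarrow> real ^ 'p \<Rightarrow> real"
  assumes "prob_space M"
    and "exchangeable M (restrict_space borel (\<X> \<times> \<Y>)) (n + 1) (\<lambda>i \<omega>. (X i \<omega>, Y i \<omega>))"
    and "rkhs \<X> app"
    and "lam > 0"
    and "\<And>D. D \<noteq> {#} \<Longrightarrow> set_mset D \<subseteq> \<X> \<times> \<Y> \<Longrightarrow> \<exists>!f. is_minimizer (reg_risk app l lam D) f"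
    and "1 / (real n + 1) \<le> \<alpha>" and "\<alpha> < 1"
    and "AE \<omega> in M. \<forall>y\<in>\<Y>. \<forall>x\<in>\<X>. \<forall>u\<in>\<Y>.
           S_lo \<omega> y x u \<le> score app l lam s (augmented_data n (sample X Y \<omega>) y) x u \<and>
           score app l lam s (augmented_data n (sample X Y \<omega>) y) x u \<le> S_up \<omega> y x u"
    \<comment> \<open>measurability of the two coverage events; the first one as an event in the sample space\<close>
    and "{z \<in> space (Pi\<^sub>M {1..n+1} (\<lambda>_. restrict_space borel (\<X> \<times> \<Y>))).
            snd (z (n + 1)) \<in> full_region \<Y> n \<alpha> (score app l lam s) z}
           \<in> sets (Pi\<^sub>M {1..n+1} (\<lambda>_. restrict_space borel (\<X> \<times> \<Y>)))"
    and "{\<omega> \<in> space M. Y (n + 1) \<omega> \<in> upper_region \<Y> n \<alpha> (S_up \<omega>) (S_lo \<omega>) (sample X Y \<omega>)} \<in> sets M"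
  shows "(AE \<omega> in M. full_region \<Y> n \<alpha> (score app l lam s) (sample X Y \<omega>)
                        \<subseteq> upper_region \<Y> n \<alpha> (S_up \<omega>) (S_lo \<omega>) (sample X Y \<omega>)) \<and>
         measure M {\<omega> \<in> space M. Y (n + 1) \<omega> \<in> upper_region \<Y> n \<alpha> (S_up \<omega>) (S_lo \<omega>) (sample X Y \<omega>)}
           \<ge> measure M {\<omega> \<in> space M. Y (n + 1) \<omega> \<in> full_region \<Y> n \<alpha> (score app l lam s) (sample X Y \<omega>)} \<and>
         measure M {\<omega> \<in> space M. Y (n + 1) \<omega> \<in> full_region \<Y> n \<alpha> (score app l lam s) (sample X Y \<omega>)} \<ge> 1 - \<alpha>"
proof -
  interpret prob_space M by fact
  let ?R = "restrict_space borel (\<X> \<times> \<Y>)" and ?S = "score app l lam s"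
  let ?full = "{\<omega> \<in> space M. Y (n + 1) \<omega> \<in> full_region \<Y> n \<alpha> ?S (sample X Y \<omega>)}"
  let ?up = "{\<omega> \<in> space M. Y (n + 1) \<omega> \<in> upper_region \<Y> n \<alpha> (S_up \<omega>) (S_lo \<omega>) (sample X Y \<omega>)}"
  \<comment> \<open>Measurability into the restricted space confines every realization, not just
    almost every one, to \<open>\<X> \<times> \<Y>\<close>.\<close>
  have sample_in: "sample X Y \<omega> i \<in> \<X> \<times> \<Y>" if "\<omega> \<in> space M" "i \<in> {1..n+1}" for \<omega> i
  proof -
    have "(\<lambda>\<omega>. (X i \<omega>, Y i \<omega>)) \<in> M \<rightarrow>\<^sub>M ?R"
      using assms(2) that(2) unfolding exchangeable_def by blast
    from measurable_space[OF this that(1)] show ?thesis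
      by (simp add: sample_def space_restrict_space)
  qed
  \<comment> \<open>The score bounds hold for all \<open>y\<close>, \<open>x\<close>,
    \<open>u\<close> outside a single null set, so the deterministic inclusion applies to all
    candidates at once.\<close>
  have incl: "AE \<omega> in M. full_region \<Y> n \<alpha> ?S (sample X Y \<omega>)
      \<subseteq> upper_region \<Y> n \<alpha> (S_up \<omega>) (S_lo \<omega>) (sample X Y \<omega>)"
    using assms(8) AE_space
  proof eventually_elim
    case (elim \<omega>)
    then show ?case
      using sample_in by (intro full_region_subset_upper_region[where \<X> = \<X>]) auto
  qed
  have nonneg: "0 \<le> \<alpha>"
    using assms(6) by (rule order_trans[rotated]) simp
  \<comment> \<open>The open premise, that responses lie in \<open>\<Y>\<close>, is discharged below
    from the space of \<open>?R\<close>.\<close>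
  note coverage = full_region_coverage[OF assms(1,2) _ nonneg assms(9)]
  have full: "?full \<in> sets M" "1 - \<alpha> \<le> prob ?full"
    using coverage by (auto simp: space_restrict_space sample_def[abs_def])
  \<comment> \<open>Monotonicity up to a null set requires the larger event to be measurable, which
    is the assumption on the upper coverage event.\<close>
  have "prob ?full \<le> prob ?up"
    using incl assms(10) by (intro finite_measure_mono_AE) auto
  then show ?thesis
    using incl full(2) by blast
qed

end
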